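(* Let $\mathcal{A}$ be the Markov cluster algebra and let $\Bbbk$ be a field. - (X) For each $\beta,\gamma\in\Bbbk$ with $\beta^2+\gamma^2=0$, there is a unique deep point $p\in V(\mathcal{A},\Bbbk)$ which kills every $x$-type cluster variable and sends $(y,z)$ to $(\beta,\gamma)$. - (Y) For each $\beta,\gamma\in\Bbbk$ with $\beta^2+\gamma^2=0$, there is a unique deep point $p\in V(\mathcal{A},\Bbbk)$ which kills every $y$-type cluster variable and sends $(x,z)$ to $(\beta,\gamma)$. - (Z) For each $\beta,\gamma\in\Bbbk$ with $\beta^2+\gamma^2=0$, there is a unique deep point $p\in V(\mathcal{A},\Bbbk)$ which kills every $z$-type cluster variable and sends $(x,y)$ to $(\beta,\gamma)$. Every deep point in $V(\mathcal{A},\Bbbk)$ is one of these three types, which are pairwise disjoint except for the point which sends every cluster variable to $0$.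
   Context: The Markov cluster algebra $\mathcal{A}$ is the cluster algebra over $\mathbb{Z}$ (no frozen variables) of the Markov quiver, with initial cluster $\{x,y,z\}$ and two arrows $x\to y$, two arrows $y\to z$ and two arrows $z\to x$. Concretely, $\mathcal{A}$ is the subring of $\mathbb{Q}(x,y,z)$ generated by all cluster variables, where each cluster $\{\overline{x},\overline{y},\overline{z}\}$ mutates by replacing one element as follows: $\overline{x}\mapsto(\overline{y}^2+\overline{z}^2)/\overline{x}$, $\overline{y}\mapsto(\overline{x}^2+\overline{z}^2)/\overline{y}$, or $\overline{z}\mapsto(\overline{x}^2+\overline{y}^2)/\overline{z}$. The $x$-type cluster variables are defined recursively to consist of $x$ and any mutation of an $x$-type cluster variable; $y$-type and $z$-type cluster variables are defined similarly. (Every cluster variable is of exactly one type and every cluster contains one variable of each type.) $V(\mathcal{A},\Bbbk)=\mathrm{Hom}_{\mathrm{Ring}}(\mathcal{A},\Bbbk)$; $p$ kills $a$ if $p(a)=0$. A point $p$ is deep if it kills at least one cluster variable in every cluster. *)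

theory Defs
  imports "HOL-Computational_Algebra.Computational_Algebra" "HOL-Library.FuncSet"
begin

section \<open>The Markov cluster algebra\<close>

text \<open>
  The nested polynomial ring over the rationals is the polynomial ring in three
  indeterminates, so its fraction field is the rational function field in three variables.
\<close>

type_synonym ratfun3 = "rat poly poly poly fract"

definition var_x :: ratfun3 where "var_x = Fract [:[:[:0, 1:]:]:] 1"
definition var_y :: ratfun3 where "var_y = Fract [:[:0, 1:]:] 1"
definition var_z :: ratfun3 where "var_z = Fract [:0, 1:] 1"

text \<open>
  A cluster is stored as a triple: a mutation puts the new variable in the slot of the
  variable which it replaces. The Markov quiver (two arrows each from x to y, from y to z and
  from z to x) is reversed by every mutation, so the exchange relations keep the same shape
  throughout and the quiver need not be recorded. There are no frozen variables.
\<close>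

inductive_set clusters :: "(ratfun3 \<times> ratfun3 \<times> ratfun3) set" where
  initial: "(var_x, var_y, var_z) \<in> clusters"
| mutate_x: "(a, b, c) \<in> clusters \<Longrightarrow> ((b\<^sup>2 + c\<^sup>2) / a, b, c) \<in> clusters"
| mutate_y: "(a, b, c) \<in> clusters \<Longrightarrow> (a, (a\<^sup>2 + c\<^sup>2) / b, c) \<in> clusters"
| mutate_z: "(a, b, c) \<in> clusters \<Longrightarrow> (a, b, (a\<^sup>2 + b\<^sup>2) / c) \<in> clusters"

definition cluster_variables :: "ratfun3 set" where
  "cluster_variables = (\<Union>(a, b, c)\<in>clusters. {a, b, c})"

text \<open>
  \<open>mutates_to u v\<close>: some cluster contains \<open>u\<close>, and its mutation at \<open>u\<close> replaces \<open>u\<close> by \<open>v\<close>.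
\<close>

inductive mutates_to :: "ratfun3 \<Rightarrow> ratfun3 \<Rightarrow> bool" where
  at_x: "(a, b, c) \<in> clusters \<Longrightarrow> mutates_to a ((b\<^sup>2 + c\<^sup>2) / a)"
| at_y: "(a, b, c) \<in> clusters \<Longrightarrow> mutates_to b ((a\<^sup>2 + c\<^sup>2) / b)"
| at_z: "(a, b, c) \<in> clusters \<Longrightarrow> mutates_to c ((a\<^sup>2 + b\<^sup>2) / c)"

text \<open>
  For an initial variable \<open>v\<close>, the cluster variables of the type of \<open>v\<close>; the type is not read
  off from the slot in a triple.
\<close>

inductive_set variables_of_type :: "ratfun3 \<Rightarrow> ratfun3 set" for v :: ratfun3 where
  base: "v \<in> variables_of_type v"
| step: "u \<in> variables_of_type v \<Longrightarrow> mutates_to u w \<Longrightarrow> w \<in> variables_of_type v"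

definition is_subring :: "'a::ring_1 set \<Rightarrow> bool" where
  "is_subring S \<longleftrightarrow> 1 \<in> S \<and> (\<forall>a\<in>S. \<forall>b\<in>S. a - b \<in> S \<and> a * b \<in> S)"

definition markov_algebra :: "ratfun3 set" where
  "markov_algebra = is_subring hull cluster_variables"


section \<open>Points and deep points\<close>

text \<open>
  The unital ring homomorphisms from the Markov cluster algebra to a field. They are made
  \<open>undefined\<close> outside the algebra, so that equality of points is equality of homomorphisms.
\<close>

definition points :: "(ratfun3 \<Rightarrow> 'k::field) set" where
  "points = {p \<in> extensional markov_algebra.
     p 1 = 1 \<and>
     (\<forall>a\<in>markov_algebra. \<forall>b\<in>markov_algebra. p (a + b) = p a + p b \<and> p (a * b) = p a * p b)}"

definition deep_points :: "(ratfun3 \<Rightarrow> 'k::field) set" where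
  "deep_points = {p \<in> points. \<forall>(a, b, c)\<in>clusters. \<exists>v\<in>{a, b, c}. p v = 0}"

text \<open>
  In both definitions below, \<open>v\<close> is the initial variable whose type is killed, and \<open>u\<close>, \<open>w\<close>
  are the other two initial variables.
\<close>

definition deep_points_at ::
  "ratfun3 \<Rightarrow> ratfun3 \<Rightarrow> ratfun3 \<Rightarrow> 'k::field \<Rightarrow> 'k \<Rightarrow> (ratfun3 \<Rightarrow> 'k) set" where
  "deep_points_at v u w \<beta> \<gamma> =
     {p \<in> deep_points. (\<forall>a\<in>variables_of_type v. p a = 0) \<and> p u = \<beta> \<and> p w = \<gamma>}"

definition deep_points_of_type ::
  "ratfun3 \<Rightarrow> ratfun3 \<Rightarrow> ratfun3 \<Rightarrow> (ratfun3 \<Rightarrow> 'k::field) set" where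
  "deep_points_of_type v u w =
     {p. \<exists>\<beta> \<gamma>. \<beta>\<^sup>2 + \<gamma>\<^sup>2 = 0 \<and> p \<in> deep_points_at v u w \<beta> \<gamma>}"

end

theory Submission
  imports Defs Complex_Main
begin

text \<open>
  Put \<open>M = (x\<^sup>2 + y\<^sup>2 + z\<^sup>2) / (x y z)\<close>. Every cluster \<open>(a, b, c)\<close> satisfies the Markov equation
  \<open>a\<^sup>2 + b\<^sup>2 + c\<^sup>2 = a b c M\<close> with this same \<open>M\<close>, so a mutation is a Vieta jump: the new variable
  \<open>(b\<^sup>2 + c\<^sup>2) / a\<close> is the other root \<open>b c M - a\<close> of the quadratic equation for \<open>a\<close>. Hence the
  cluster algebra lies in the ring \<open>R = \<int>[x, y, z, M]\<close>.

  The ring \<open>R\<close> has no relations beyond the Markov equation. That equation is monic and quadratic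
  in \<open>z\<close>, so it brings every element into the form \<open>A(x, y, M) + z B(x, y, M)\<close> with integer
  polynomials \<open>A\<close> and \<open>B\<close>, and these are unique (\<open>markov_normal_form_unique\<close>). Consequently every
  solution \<open>(\<alpha>, \<beta>, \<gamma>, \<mu>)\<close> of the Markov equation in a commutative ring comes from a ring
  homomorphism on \<open>R\<close> (\<open>markov_ring_hom_exists\<close>). If \<open>\<mu> = 0\<close>, the Vieta jump shows that this
  homomorphism changes sign at every mutation. So whenever \<open>\<alpha>\<^sup>2 + \<beta>\<^sup>2 + \<gamma>\<^sup>2 = 0\<close> there is a point
  of the cluster algebra which takes the values \<open>\<plusminus>\<alpha>\<close>, \<open>\<plusminus>\<beta>\<close>, \<open>\<plusminus>\<gamma>\<close> on every cluster, and it is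
  deep as soon as one of the three numbers is zero.

  Conversely, at a deep point \<open>p\<close> every cluster has a killed variable, and the exchange relation of
  that variable gives \<open>p(a)\<^sup>2 + p(b)\<^sup>2 + p(c)\<^sup>2 = 0\<close> for every cluster (\<open>deep_sum_of_squares\<close>).
  Comparing neighbouring clusters, \<open>p\<close> again changes sign at every mutation (\<open>deep_mutation\<close>).
  Therefore a deep point is determined by its values at \<open>x\<close>, \<open>y\<close>, \<open>z\<close>, it kills all variables of
  a type if and only if it kills the initial one, and evaluation at the initial cluster is a
  bijection from the deep points to the triples with zero product and zero sum of squares. All
  the claims are read off from these triples.

  Two facts about clusters are needed on the way: cluster variables are nonzero, so that the
  exchange relations hold after division, and variables in different positions are distinct, so
  that types agree with positions. Both follow from the complex solution \<open>3\<^sup>2 + 4\<^sup>2 + (5\<i>)\<^sup>2 = 0\<close>.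
\<close>

section \<open>Ring homomorphisms on subrings\<close>

definition ring_hom_on :: "'a::comm_ring_1 set \<Rightarrow> ('a \<Rightarrow> 'b::comm_ring_1) \<Rightarrow> bool" where
  "ring_hom_on S h \<longleftrightarrow>
     h 1 = 1 \<and> (\<forall>a\<in>S. \<forall>b\<in>S. h (a + b) = h a + h b \<and> h (a * b) = h a * h b)"

lemma is_subring_UNIV: "is_subring UNIV"
  by (simp add: is_subring_def)

lemma is_subring_hull: "is_subring (is_subring hull G)"
  by (rule hull_in) (auto simp: is_subring_def)

context
  fixes S :: "'a::comm_ring_1 set"
  assumes S: "is_subring S"
begin

lemma subring_1: "1 \<in> S"
  and subring_diff: "a \<in> S \<Longrightarrow> b \<in> S \<Longrightarrow> a - b \<in> S"
  and subring_mult: "a \<in> S \<Longrightarrow> b \<in> S \<Longrightarrow> a * b \<in> S"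
  using S by (auto simp: is_subring_def)

lemma subring_0: "0 \<in> S"
  using subring_diff[OF subring_1 subring_1] by simp

lemma subring_add: "a \<in> S \<Longrightarrow> b \<in> S \<Longrightarrow> a + b \<in> S"
  using subring_diff[of a "0 - b"] subring_diff[OF subring_0, of b] by simp

lemma ring_hom_on_0:
  assumes "ring_hom_on S h"
  shows "h 0 = 0"
proof -
  have "h (0 + 0) = h 0 + h 0"
    using assms subring_0 unfolding ring_hom_on_def by blast
  then show ?thesis by simp
qed

lemma ring_hom_on_diff:
  assumes "ring_hom_on S h" "a \<in> S" "b \<in> S"
  shows "h (a - b) = h a - h b"
proof -
  have "h ((a - b) + b) = h (a - b) + h b"
    using assms subring_diff unfolding ring_hom_on_def by blast
  then show ?thesis by simp
qed

end

lemma ring_hom_on_subset: "ring_hom_on S h \<Longrightarrow> T \<subseteq> S \<Longrightarrow> ring_hom_on T h"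
  unfolding ring_hom_on_def by blast

lemma ring_hom_on_hull_eqI:
  assumes hom: "ring_hom_on (is_subring hull G) p" "ring_hom_on (is_subring hull G) q"
    and eq: "\<And>g. g \<in> G \<Longrightarrow> p g = q g"
    and a: "a \<in> is_subring hull G"
  shows "p a = q a"
proof -
  let ?H = "is_subring hull G"
  have H: "is_subring ?H" by (rule is_subring_hull)
  have "is_subring {a \<in> ?H. p a = q a}"
    using hom subring_1[OF H] subring_diff[OF H] subring_mult[OF H]
    by (auto simp: is_subring_def ring_hom_on_diff[OF H]) (auto simp: ring_hom_on_def)
  moreover have "G \<subseteq> {a \<in> ?H. p a = q a}"
    using eq by (auto simp: hull_inc)
  ultimately have "?H \<subseteq> {a \<in> ?H. p a = q a}" by (rule hull_minimal[rotated])
  then show ?thesis using a by blast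
qed


section \<open>Evaluation of integer polynomials in three variables\<close>

lemma ring_hom_map_poly:
  assumes "ring_hom_on UNIV h"
  shows "ring_hom_on UNIV (map_poly h)"
proof -
  have 0: "h 0 = 0" by (rule ring_hom_on_0[OF is_subring_UNIV assms])
  have sum: "h (sum f I) = (\<Sum>i\<in>I. h (f i))" for f and I :: "nat set"
    using assms 0 by (induction I rule: infinite_finite_induct) (auto simp: ring_hom_on_def)
  show ?thesis
    unfolding ring_hom_on_def using assms
    by (auto simp: poly_eq_iff coeff_map_poly 0 coeff_mult sum ring_hom_on_def)
qed

lemma ring_hom_eval:
  assumes "ring_hom_on UNIV h"
  shows "ring_hom_on UNIV (\<lambda>p. poly (map_poly h p) a)"
  using ring_hom_map_poly[OF assms] by (auto simp: ring_hom_on_def)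

lemma ring_hom_of_int: "ring_hom_on UNIV (of_int :: int \<Rightarrow> 'a::comm_ring_1)"
  by (simp add: ring_hom_on_def)

definition eval2 :: "'a::comm_ring_1 \<Rightarrow> 'a \<Rightarrow> int poly poly \<Rightarrow> 'a" where
  "eval2 a b q = poly (map_poly (\<lambda>r. poly (map_poly of_int r) a) q) b"

definition eval3 :: "'a::comm_ring_1 \<Rightarrow> 'a \<Rightarrow> 'a \<Rightarrow> int poly poly poly \<Rightarrow> 'a" where
  "eval3 a b m q = poly (map_poly (eval2 a b) q) m"

lemma ring_hom_eval2: "ring_hom_on UNIV (eval2 a b)"
  unfolding eval2_def by (intro ring_hom_eval ring_hom_of_int)

lemma ring_hom_eval3: "ring_hom_on UNIV (eval3 a b m)"
  unfolding eval3_def by (intro ring_hom_eval ring_hom_eval2)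

lemma eval3_simps [simp]:
  "eval3 a b m 0 = 0" "eval3 a b m 1 = 1"
  "eval3 a b m (p + q) = eval3 a b m p + eval3 a b m q"
  "eval3 a b m (p - q) = eval3 a b m p - eval3 a b m q"
  "eval3 a b m (p * q) = eval3 a b m p * eval3 a b m q"
  using ring_hom_eval3[of a b m]
  by (auto simp: ring_hom_on_0[OF is_subring_UNIV] ring_hom_on_diff[OF is_subring_UNIV])
    (auto simp: ring_hom_on_def)

lemma eval3_indeterminates [simp]:
  "eval3 a b m [:[:[:0, 1:]:]:] = a" "eval3 a b m [:[:0, 1:]:] = b" "eval3 a b m [:0, 1:] = m"
  by (simp_all add: eval3_def eval2_def map_poly_pCons)

section \<open>Independence of the Markov quotient\<close>

lemma to_fract_power: "to_fract (a ^ n) = to_fract a ^ n"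
  by (induction n) simp_all

text \<open>
  The numerator of \<open>\<Sum>i\<le>n. a i * (numer / denom) ^ i\<close> over the denominator \<open>denom ^ n\<close>. The Horner
  recursion isolates the last coefficient, which is the one that the induction below removes.
\<close>

fun homog :: "'d::comm_ring_1 poly \<Rightarrow> 'd poly \<Rightarrow> (nat \<Rightarrow> 'd) \<Rightarrow> nat \<Rightarrow> 'd poly" where
  "homog numer denom a 0 = [:a 0:]"
| "homog numer denom a (Suc n) = denom * homog numer denom a n + smult (a (Suc n)) (numer ^ Suc n)"

context
  fixes s t :: "'d::idom"
begin

text \<open>
  As a function of \<open>z\<close>, the element \<open>M\<close> is \<open>(s + z\<^sup>2) / (t z)\<close> with \<open>s = x\<^sup>2 + y\<^sup>2\<close> and \<open>t = x y\<close>.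
  All that matters about \<open>s\<close> and \<open>t\<close> is that they are nonzero and do not involve \<open>z\<close>.
\<close>

abbreviation (input) "numer \<equiv> [:s, 0, 1:]"
abbreviation (input) "denom \<equiv> [:0, t:]"

lemma degree_numer_power: "degree (numer ^ n) = 2 * n"
  by (subst degree_power_eq) auto

lemma coeff_numer_power: "coeff (numer ^ n) (2 * n) = 1"
proof -
  have "lead_coeff (numer ^ n) = 1" by (simp add: lead_coeff_power)
  then show ?thesis by (simp only: degree_numer_power)
qed

lemma degree_homog: "degree (homog numer denom a n) \<le> 2 * n"
proof (induction n)
  case (Suc n)
  have "degree (denom * homog numer denom a n) \<le> 1 + 2 * n"
    using degree_mult_le[of denom "homog numer denom a n"] Suc by (auto split: if_splits)
  moreover have "degree (smult (a (Suc n)) (numer ^ Suc n)) \<le> 2 * Suc n"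
    using degree_smult_le[of "a (Suc n)" "numer ^ Suc n"] by (simp only: degree_numer_power)
  ultimately show ?case by (simp only: homog.simps) (intro degree_add_le; simp)
qed simp

lemma coeff_homog_top: "coeff (homog numer denom a n) (2 * n) = a n"
proof (cases n)
  case (Suc m)
  have "degree (denom * homog numer denom a m) \<le> 1 + 2 * m"
    using degree_mult_le[of denom "homog numer denom a m"] degree_homog[of a m] by (auto split: if_splits)
  then have "coeff (denom * homog numer denom a m) (2 * Suc m) = 0"
    by (intro coeff_eq_0) simp
  then show ?thesis
    unfolding Suc homog.simps coeff_add coeff_smult coeff_numer_power by simp
qed simp

lemma coeff_homog_0: "coeff (homog numer denom a n) 0 = a n * s ^ n"
  by (cases n) (simp_all add: coeff_mult coeff_0_power)

text \<open>
  The element \<open>M\<close> has simple poles at both \<open>z = 0\<close> and \<open>z = \<infinity>\<close>, whereas \<open>z\<close> itself vanishes at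
  \<open>0\<close>. So the coefficient of \<open>M ^ n\<close> in the part without the factor \<open>z\<close> is seen alone at \<open>z = 0\<close>,
  in the constant term of the numerators, and the one in the part with the factor \<open>z\<close> is seen
  alone at infinity, in degree \<open>2 * n + 1\<close>. Once both are zero, the numerators share the factor
  \<open>denom\<close>, and \<open>n\<close> can be lowered.
\<close>

lemma homog_independent:
  assumes "s \<noteq> 0" "t \<noteq> 0"
  shows "homog numer denom a n + [:0, 1:] * homog numer denom b n = 0 \<Longrightarrow> i \<le> n \<Longrightarrow> a i = 0 \<and> b i = 0"
proof (induction n arbitrary: i)
  case 0
  then show ?case by simp
next
  case (Suc n)
  have a: "a (Suc n) = 0"
    using arg_cong[OF Suc.prems(1), of "\<lambda>p. coeff p 0"] assms
    unfolding coeff_add coeff_homog_0 by simp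
  have "coeff (homog numer denom a (Suc n)) (Suc (2 * Suc n)) = 0"
    by (rule coeff_eq_0) (use degree_homog[of a "Suc n"] in simp)
  then have b: "b (Suc n) = 0"
    using arg_cong[OF Suc.prems(1), of "\<lambda>p. coeff p (Suc (2 * Suc n))"]
      coeff_homog_top[of b "Suc n"]
    by (simp del: homog.simps)
  have "denom * (homog numer denom a n + [:0, 1:] * homog numer denom b n) = 0"
    using Suc.prems(1) a b by (simp add: algebra_simps)
  moreover have "denom \<noteq> 0" using assms by simp
  ultimately have "homog numer denom a n + [:0, 1:] * homog numer denom b n = 0"
    by (metis mult_eq_0_iff)
  then show ?case using Suc a b by (cases "i = Suc n") auto
qed

lemma eval_homog:
  assumes "t \<noteq> 0" "degree A \<le> n"
  shows "poly (map_poly (\<lambda>d. to_fract [:d:]) A) (to_fract numer / to_fract denom) * to_fract denom ^ n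
    = to_fract (homog numer denom (coeff A) n)"
proof -
  have denom: "to_fract denom \<noteq> 0" using assms by simp
  have *: "(\<Sum>i\<le>k. to_fract [:a i:] * (to_fract numer / to_fract denom) ^ i) * to_fract denom ^ k
     = to_fract (homog numer denom a k)" for a k
  proof (induction k)
    case (Suc k)
    have "to_fract [:a (Suc k):] * (to_fract numer / to_fract denom) ^ Suc k * to_fract denom ^ Suc k
        = to_fract (smult (a (Suc k)) (numer ^ Suc k))"
      using denom to_fract_mult[of "[:a (Suc k):]" "numer ^ Suc k"]
      by (simp add: power_divide to_fract_power del: to_fract_mult power_Suc)
    then have "(\<Sum>i\<le>Suc k. to_fract [:a i:] * (to_fract numer / to_fract denom) ^ i) * to_fract denom ^ Suc k
        = to_fract denom * ((\<Sum>i\<le>k. to_fract [:a i:] * (to_fract numer / to_fract denom) ^ i) * to_fract denom ^ k)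
          + to_fract (smult (a (Suc k)) (numer ^ Suc k))"
      by (simp only: sum.atMost_Suc distrib_left distrib_right power_Suc ac_simps)
    then show ?case by (simp only: Suc homog.simps to_fract_add to_fract_mult)
  qed simp
  have "poly (map_poly (\<lambda>d. to_fract [:d:]) A) u = (\<Sum>i\<le>n. to_fract [:coeff A i:] * u ^ i)" for u
  proof -
    have "poly (map_poly (\<lambda>d. to_fract [:d:]) A) u
       = (\<Sum>i\<le>degree A. to_fract [:coeff A i:] * u ^ i)"
      by (simp add: poly_altdef coeff_map_poly degree_map_poly)
    also have "\<dots> = (\<Sum>i\<le>n. to_fract [:coeff A i:] * u ^ i)"
      using assms by (intro sum.mono_neutral_left) (auto simp: coeff_eq_0)
    finally show ?thesis .
  qed
  then show ?thesis using * by simp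
qed

end


section \<open>The ring generated by the initial cluster and the Markov quotient\<close>

definition markov_M :: ratfun3 where
  "markov_M = (var_x\<^sup>2 + var_y\<^sup>2 + var_z\<^sup>2) / (var_x * var_y * var_z)"

definition markov_ring :: "ratfun3 set" where
  "markov_ring = is_subring hull {var_x, var_y, var_z, markov_M}"

lemma initial_nonzero: "var_x \<noteq> 0" "var_y \<noteq> 0" "var_z \<noteq> 0"
  by (simp_all add: var_x_def var_y_def var_z_def flip: to_fract_def)

lemma markov_equation_initial: "var_x\<^sup>2 + var_y\<^sup>2 + var_z\<^sup>2 = var_x * var_y * var_z * markov_M"
  using initial_nonzero by (simp add: markov_M_def)

definition coeff_embed :: "int poly poly \<Rightarrow> rat poly poly" where
  "coeff_embed = map_poly (map_poly of_int)"

lemma coeff_embed_0 [simp]: "coeff_embed 0 = 0"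
  by (simp add: coeff_embed_def)

lemma coeff_embed_eq_0_iff: "coeff_embed q = 0 \<longleftrightarrow> q = 0"
  by (simp add: coeff_embed_def poly_eq_iff coeff_map_poly)

lemma eval_inner: "poly (map_poly of_int r) var_x = to_fract [:[:map_poly of_int r:]:]"
proof (induction r)
  case (pCons c r)
  have "of_int c = to_fract (of_int c :: rat poly poly poly)"
    by (induction c rule: int_induct[of _ 0]) simp_all
  then have "of_int c = to_fract [:[:[:rat_of_int c:]:]:]"
    by (simp add: of_int_poly)
  then show ?case using pCons
    by (simp add: map_poly_pCons var_x_def flip: to_fract_def to_fract_mult to_fract_add)
qed simp

lemma eval2_initial: "eval2 var_x var_y q = to_fract [:coeff_embed q:]"
proof (induction q)
  case 0
  show ?case by (simp add: eval2_def)
next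
  case (pCons r q)
  then show ?case
    by (simp add: eval2_def coeff_embed_def map_poly_pCons eval_inner var_y_def
        flip: to_fract_def to_fract_mult to_fract_add)
qed

text \<open>
  The indeterminate \<open>z\<close> is the outermost one of the function field, so \<open>z\<close> is the variable in which
  \<open>homog_independent\<close> can be applied directly, with coefficients polynomials in \<open>x\<close> and \<open>y\<close>.
\<close>

lemma markov_normal_form_unique:
  assumes "eval3 var_x var_y markov_M A + var_z * eval3 var_x var_y markov_M B = 0"
  shows "A = 0 \<and> B = 0"
proof -
  define s t :: "rat poly poly" where "s = [:[:0, 0, 1:], 0, 1:]" and "t = [:0, [:0, 1:]:]"
  have st: "s \<noteq> 0" "t \<noteq> 0" by (simp_all add: s_def t_def)
  let ?N = "[:s, 0, 1:]" and ?T = "[:0, t:]"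
  define A' B' where "A' = map_poly coeff_embed A" and "B' = map_poly coeff_embed B"
  define n where "n = max (degree A') (degree B')"
  have M: "markov_M = to_fract ?N / to_fract ?T"
    unfolding markov_M_def var_x_def var_y_def var_z_def s_def t_def
    by (simp add: power2_eq_square flip: to_fract_def to_fract_mult to_fract_add)
  have ev: "eval3 var_x var_y markov_M C * to_fract ?T ^ n
      = to_fract (homog ?N ?T (coeff (map_poly coeff_embed C)) n)"
    if "degree (map_poly coeff_embed C) \<le> n" for C
  proof -
    have "map_poly (eval2 var_x var_y) C
        = map_poly (\<lambda>d. to_fract [:d:]) (map_poly coeff_embed C)"
      by (simp add: poly_eq_iff coeff_map_poly eval2_initial)
    then show ?thesis
      unfolding eval3_def M using eval_homog[OF st(2) that] by simp
  qed
  have "to_fract (homog ?N ?T (coeff A') n + [:0, 1:] * homog ?N ?T (coeff B') n)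
      = (eval3 var_x var_y markov_M A + var_z * eval3 var_x var_y markov_M B) * to_fract ?T ^ n"
  proof -
    have "to_fract (homog ?N ?T (coeff A') n) = eval3 var_x var_y markov_M A * to_fract ?T ^ n"
      "to_fract (homog ?N ?T (coeff B') n) = eval3 var_x var_y markov_M B * to_fract ?T ^ n"
      using ev[of A] ev[of B] by (simp_all add: A'_def B'_def n_def)
    then show ?thesis
      unfolding to_fract_add to_fract_mult[of "[:0, 1:]"]
      by (simp add: var_z_def algebra_simps flip: to_fract_def)
  qed
  then have "homog ?N ?T (coeff A') n + [:0, 1:] * homog ?N ?T (coeff B') n = 0"
    by (simp only: assms mult_zero_left to_fract_eq_0_iff)
  from homog_independent[OF st this] have "coeff A' i = 0 \<and> coeff B' i = 0" if "i \<le> n" for i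
    using that by blast
  then have "A' = 0" "B' = 0"
    by (metis leading_coeff_0_iff max.cobounded1 n_def, metis leading_coeff_0_iff max.cobounded2 n_def)
  then show ?thesis
    by (simp add: A'_def B'_def poly_eq_iff[of A] poly_eq_iff[of B] poly_eq_iff[of "map_poly _ _"]
        coeff_map_poly coeff_embed_eq_0_iff)
qed

text \<open>
  The homomorphism sends \<open>A(x, y, M) + z B(x, y, M)\<close> to \<open>A(\<alpha>, \<beta>, \<mu>) + \<gamma> B(\<alpha>, \<beta>, \<mu>)\<close>. It is well
  defined because normal forms are unique, and multiplicative because products are reduced to
  normal form by the Markov equation alone, which holds on both sides. The quadratic equation
  is monic over the integers, so the target ring can have any characteristic.
\<close>

lemma markov_ring_hom_exists:
  fixes \<alpha> \<beta> \<gamma> \<mu> :: "'a::comm_ring_1"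
  assumes eq: "\<alpha>\<^sup>2 + \<beta>\<^sup>2 + \<gamma>\<^sup>2 = \<alpha> * \<beta> * \<gamma> * \<mu>"
  obtains h where "ring_hom_on markov_ring h"
    "h var_x = \<alpha>" "h var_y = \<beta>" "h var_z = \<gamma>" "h markov_M = \<mu>"
proof -
  define nf where
    "nf = (\<lambda>(A, B). eval3 var_x var_y markov_M A + var_z * eval3 var_x var_y markov_M B)"
  define ev where "ev = (\<lambda>(A, B). eval3 \<alpha> \<beta> \<mu> A + \<gamma> * eval3 \<alpha> \<beta> \<mu> B)"
  define h where "h = ev \<circ> inv nf"
  have "inj nf"
  proof (rule injI)
    fix P Q assume "nf P = nf Q"
    then have "eval3 var_x var_y markov_M (fst P - fst Q)
        + var_z * eval3 var_x var_y markov_M (snd P - snd Q) = 0"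
      by (simp add: nf_def case_prod_unfold algebra_simps)
    from markov_normal_form_unique[OF this] show "P = Q" by (simp add: prod_eq_iff)
  qed
  then have h: "h (nf P) = ev P" for P by (simp add: h_def)
  define X Y W :: "int poly poly poly"
    where "X = [:[:[:0, 1:]:]:]" and "Y = [:[:0, 1:]:]" and "W = [:0, 1:]"
  have indets: "eval3 a b m X = a" "eval3 a b m Y = b" "eval3 a b m W = m" for a b m :: "'b::comm_ring_1"
    by (simp_all add: X_def Y_def W_def)
  \<comment> \<open>The product rule uses \<open>z\<^sup>2 = x y z M - x\<^sup>2 - y\<^sup>2\<close> to return to normal form.\<close>
  define add diff mult :: "int poly poly poly \<times> int poly poly poly \<Rightarrow> _"
    where "add = (\<lambda>(A, B) (C, D). (A + C, B + D))"
      and "diff = (\<lambda>(A, B) (C, D). (A - C, B - D))"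
      and "mult = (\<lambda>(A, B) (C, D). 
        (A * C - (X * X + Y * Y) * B * D, A * D + B * C + X * Y * W * B * D))"
  note defs = nf_def ev_def add_def diff_def mult_def indets
  have mult_rule: "(a + g * b) * (c + g * d)
      = (a * c - (x * x + y * y) * b * d) + g * (a * d + b * c + x * y * m * b * d)"
    if "x\<^sup>2 + y\<^sup>2 + g\<^sup>2 = x * y * g * m" for a b c d x y g m :: "'b::comm_ring_1"
  proof -
    have gg: "g * g = x * y * g * m - (x * x + y * y)"
      using that by (simp add: power2_eq_square algebra_simps)
    have "(a + g * b) * (c + g * d) = a * c + g * (a * d + b * c) + (g * g) * (b * d)"
      by (simp add: algebra_simps)
    then show ?thesis unfolding gg by (simp add: algebra_simps)
  qed
  have nf_ops: "nf P + nf Q = nf (add P Q)" "nf P - nf Q = nf (diff P Q)"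
    "nf P * nf Q = nf (mult P Q)" for P Q
    by (cases P; cases Q; simp add: defs mult_rule[OF markov_equation_initial]; simp add: algebra_simps)+
  have ev_ops: "ev P + ev Q = ev (add P Q)" "ev P * ev Q = ev (mult P Q)" for P Q
    by (cases P; cases Q; simp add: defs mult_rule[OF eq]; simp add: algebra_simps)+
  have gens: "nf (1, 0) = 1" "nf (X, 0) = var_x" "nf (Y, 0) = var_y" "nf (0, 1) = var_z"
    "nf (W, 0) = markov_M"
    "ev (1, 0) = 1" "ev (X, 0) = \<alpha>" "ev (Y, 0) = \<beta>" "ev (0, 1) = \<gamma>" "ev (W, 0) = \<mu>"
    by (simp_all add: defs)
  have "ring_hom_on (range nf) h"
    unfolding ring_hom_on_def using h[of "(1, 0)"]
    by (auto simp: nf_ops ev_ops h gens)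
  moreover have "is_subring (range nf)"
    unfolding is_subring_def using rangeI[of nf "(1, 0)"] by (auto simp: nf_ops gens)
  then have "markov_ring \<subseteq> range nf"
    unfolding markov_ring_def
    by (intro hull_minimal) (auto simp flip: gens(2-5))
  ultimately have "ring_hom_on markov_ring h" by (blast intro: ring_hom_on_subset)
  moreover have "h var_x = \<alpha>" "h var_y = \<beta>" "h var_z = \<gamma>" "h markov_M = \<mu>"
    using h[of "(X, 0)"] h[of "(Y, 0)"] h[of "(0, 1)"] h[of "(W, 0)"] by (simp_all add: gens)
  ultimately show ?thesis using that by blast
qed


section \<open>Clusters as solutions of the Markov equation\<close>

lemma markov_Vieta:
  fixes a b c m :: "'a::field"
  assumes "a \<noteq> 0" "a\<^sup>2 + b\<^sup>2 + c\<^sup>2 = a * b * c * m"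
  shows "(b\<^sup>2 + c\<^sup>2) / a = b * c * m - a"
  using assms by (simp add: field_simps power2_eq_square)

lemma markov_equation_Vieta:
  fixes a b c m :: "'a::comm_ring_1"
  assumes "a\<^sup>2 + b\<^sup>2 + c\<^sup>2 = a * b * c * m"
  shows "(b * c * m - a)\<^sup>2 + b\<^sup>2 + c\<^sup>2 = (b * c * m - a) * b * c * m"
  using assms by (simp add: power2_eq_square algebra_simps)

lemma is_subring_markov_ring: "is_subring markov_ring"
  unfolding markov_ring_def by (rule is_subring_hull)

lemma generators_in_markov_ring:
  "var_x \<in> markov_ring" "var_y \<in> markov_ring" "var_z \<in> markov_ring" "markov_M \<in> markov_ring"
  by (simp_all add: markov_ring_def hull_inc)

lemma hom_Vieta:
  assumes "ring_hom_on markov_ring h" "h markov_M = 0"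
    and "a \<in> markov_ring" "b \<in> markov_ring" "c \<in> markov_ring"
  shows "b * c * markov_M - a \<in> markov_ring" "h (b * c * markov_M - a) = - h a"
proof -
  note R = is_subring_markov_ring
  have bc: "b * c \<in> markov_ring" by (rule subring_mult[OF R assms(4,5)])
  then have m: "b * c * markov_M \<in> markov_ring"
    by (rule subring_mult[OF R _ generators_in_markov_ring(4)])
  then show "b * c * markov_M - a \<in> markov_ring" by (rule subring_diff[OF R _ assms(3)])
  have "h (b * c * markov_M) = h (b * c) * h markov_M"
    using assms(1) bc generators_in_markov_ring unfolding ring_hom_on_def by blast
  then show "h (b * c * markov_M - a) = - h a"
    using ring_hom_on_diff[OF R assms(1) m] assms by simp
qed

text \<open>
  The hypothesis \<open>nz\<close> breaks a circularity. Mutation is a Vieta jump only for nonzero variables;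
  for the first homomorphism to which this is applied, nonzero variables are recognised by their
  values, and afterwards all cluster variables are known to be nonzero.
\<close>

lemma cluster_values:
  fixes h :: "ratfun3 \<Rightarrow> 'a::comm_ring_1"
  assumes h: "ring_hom_on markov_ring h"
      "h var_x = \<alpha>" "h var_y = \<beta>" "h var_z = \<gamma>" "h markov_M = 0"
    and nz: "\<And>a b c. (a, b, c) \<in> clusters \<Longrightarrow> h a \<in> {\<alpha>, - \<alpha>} \<Longrightarrow> h b \<in> {\<beta>, - \<beta>} \<Longrightarrow>
        h c \<in> {\<gamma>, - \<gamma>} \<Longrightarrow> a \<noteq> 0 \<and> b \<noteq> 0 \<and> c \<noteq> 0"
    and cluster: "(a, b, c) \<in> clusters"
  shows "a \<in> markov_ring \<and> b \<in> markov_ring \<and> c \<in> markov_ring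
    \<and> a\<^sup>2 + b\<^sup>2 + c\<^sup>2 = a * b * c * markov_M
    \<and> h a \<in> {\<alpha>, - \<alpha>} \<and> h b \<in> {\<beta>, - \<beta>} \<and> h c \<in> {\<gamma>, - \<gamma>}"
  using cluster
proof (induction a b c rule: clusters.induct[split_format (complete)])
  case initial
  show ?case using h generators_in_markov_ring markov_equation_initial by simp
next
  case (mutate_x a b c)
  then have eq: "(b\<^sup>2 + c\<^sup>2) / a = b * c * markov_M - a"
    using nz by (intro markov_Vieta) auto
  show ?case unfolding eq
    using mutate_x hom_Vieta[OF h(1,5), of a b c] markov_equation_Vieta[of a b c markov_M] by auto
next
  case (mutate_y a b c)
  then have m: "b\<^sup>2 + a\<^sup>2 + c\<^sup>2 = b * a * c * markov_M" by (simp add: algebra_simps)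
  have eq: "(a\<^sup>2 + c\<^sup>2) / b = a * c * markov_M - b"
    using nz mutate_y by (intro markov_Vieta m) auto
  show ?case unfolding eq
    using mutate_y hom_Vieta[OF h(1,5), of b a c] markov_equation_Vieta[OF m]
    by (auto simp: add.left_commute mult.left_commute mult.assoc add.assoc)
next
  case (mutate_z a b c)
  then have m: "c\<^sup>2 + a\<^sup>2 + b\<^sup>2 = c * a * b * markov_M" by (simp add: algebra_simps)
  have eq: "(a\<^sup>2 + b\<^sup>2) / c = a * b * markov_M - c"
    using nz mutate_z by (intro markov_Vieta m) auto
  show ?case unfolding eq
    using mutate_z hom_Vieta[OF h(1,5), of c a b] markov_equation_Vieta[OF m]
    by (auto simp: ac_simps)
qed

text \<open>
  The solution \<open>(3, 4, 5\<i>)\<close> is chosen because its entries are nonzero and different up to sign, so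
  the value at a cluster variable reveals the position of the variable.
\<close>

lemma separating_hom_exists:
  obtains h :: "ratfun3 \<Rightarrow> complex" where "ring_hom_on markov_ring h"
    "\<And>a b c. (a, b, c) \<in> clusters \<Longrightarrow>
      a \<in> markov_ring \<and> b \<in> markov_ring \<and> c \<in> markov_ring
      \<and> h a \<in> {3, - 3} \<and> h b \<in> {4, - 4} \<and> h c \<in> {5 * \<i>, - (5 * \<i>)}"
proof -
  have "(3::complex)\<^sup>2 + 4\<^sup>2 + (5 * \<i>)\<^sup>2 = 3 * 4 * (5 * \<i>) * 0"
    by (simp add: power_mult_distrib)
  then obtain h where h: "ring_hom_on markov_ring h" "h var_x = 3" "h var_y = 4" "h var_z = 5 * \<i>"
    "h markov_M = (0 :: complex)"
    by (rule markov_ring_hom_exists)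
  have "h 0 = 0" by (rule ring_hom_on_0[OF is_subring_markov_ring h(1)])
  then have "a \<noteq> 0 \<and> b \<noteq> 0 \<and> c \<noteq> 0"
    if "h a \<in> {3, - 3}" "h b \<in> {4, - 4}" "h c \<in> {5 * \<i>, - (5 * \<i>)}" for a b c
    using that by auto
  from cluster_values[OF h this] show ?thesis using that[OF h(1)] by blast
qed

lemma cluster_nonzero:
  assumes "(a, b, c) \<in> clusters"
  shows "a \<noteq> 0" "b \<noteq> 0" "c \<noteq> 0"
proof -
  obtain h :: "ratfun3 \<Rightarrow> complex" where h: "ring_hom_on markov_ring h"
    "h a \<in> {3, - 3} \<and> h b \<in> {4, - 4} \<and> h c \<in> {5 * \<i>, - (5 * \<i>)}"
    using separating_hom_exists assms by metis
  have "h 0 = 0" by (rule ring_hom_on_0[OF is_subring_markov_ring h(1)])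
  then show "a \<noteq> 0" "b \<noteq> 0" "c \<noteq> 0" using h(2) by auto
qed

lemma cluster_slots_distinct:
  assumes "(a, b, c) \<in> clusters" "(a', b', c') \<in> clusters"
  shows "a \<noteq> b'" "a \<noteq> c'" "b \<noteq> c'"
proof -
  obtain h :: "ratfun3 \<Rightarrow> complex" where
    "\<And>a b c. (a, b, c) \<in> clusters \<Longrightarrow>
      h a \<in> {3, - 3} \<and> h b \<in> {4, - 4} \<and> h c \<in> {5 * \<i>, - (5 * \<i>)}"
    using separating_hom_exists by metis
  note this[OF assms(1)] this[OF assms(2)]
  then show "a \<noteq> b'" "a \<noteq> c'" "b \<noteq> c'" by (auto simp: complex_eq_iff)
qed

lemma cluster_types:
  assumes "(a, b, c) \<in> clusters"
  shows "a \<in> variables_of_type var_x \<and> b \<in> variables_of_type var_y \<and> c \<in> variables_of_type var_z"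
  using assms
  by (induction a b c rule: clusters.induct[split_format (complete)])
    (auto intro: variables_of_type.intros mutates_to.intros)

text \<open>
  A mutation along which a type is traced could in principle start from a cluster that holds
  the variable in another position; \<open>cluster_slots_distinct\<close> excludes this.
\<close>

lemma variables_of_type_x_iff: "a \<in> variables_of_type var_x \<longleftrightarrow> (\<exists>b c. (a, b, c) \<in> clusters)"
proof
  assume "a \<in> variables_of_type var_x"
  then show "\<exists>b c. (a, b, c) \<in> clusters"
  proof induction
    case base
    show ?case using clusters.initial by blast
  next
    case (step u w)
    from step(2,3) show ?case
      by cases (blast intro: clusters.intros dest: cluster_slots_distinct)+
  qed
qed (use cluster_types in blast)

lemma variables_of_type_y_iff: "b \<in> variables_of_type var_y \<longleftrightarrow> (\<exists>a c. (a, b, c) \<in> clusters)"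
proof
  assume "b \<in> variables_of_type var_y"
  then show "\<exists>a c. (a, b, c) \<in> clusters"
  proof induction
    case base
    show ?case using clusters.initial by blast
  next
    case (step u w)
    from step(2,3) show ?case
      by cases (blast intro: clusters.intros dest: cluster_slots_distinct)+
  qed
qed (use cluster_types in blast)

lemma variables_of_type_z_iff: "c \<in> variables_of_type var_z \<longleftrightarrow> (\<exists>a b. (a, b, c) \<in> clusters)"
proof
  assume "c \<in> variables_of_type var_z"
  then show "\<exists>a b. (a, b, c) \<in> clusters"
  proof induction
    case base
    show ?case using clusters.initial by blast
  next
    case (step u w)
    from step(2,3) show ?case
      by cases (blast intro: clusters.intros dest: cluster_slots_distinct)+
  qed
qed (use cluster_types in blast)

section \<open>Deep points\<close>

lemma is_subring_markov_algebra: "is_subring markov_algebra"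
  unfolding markov_algebra_def by (rule is_subring_hull)

lemma points_iff: "p \<in> points \<longleftrightarrow> p \<in> extensional markov_algebra \<and> ring_hom_on markov_algebra p"
  by (simp add: points_def ring_hom_on_def)

lemma cluster_in_markov_algebra:
  assumes "(a, b, c) \<in> clusters"
  shows "a \<in> markov_algebra" "b \<in> markov_algebra" "c \<in> markov_algebra"
  unfolding markov_algebra_def cluster_variables_def
  by (rule hull_inc, use assms in force)+

lemma markov_algebra_subset: "markov_algebra \<subseteq> markov_ring"
proof -
  obtain h :: "ratfun3 \<Rightarrow> complex" where
    "\<And>a b c. (a, b, c) \<in> clusters \<Longrightarrow> a \<in> markov_ring \<and> b \<in> markov_ring \<and> c \<in> markov_ring"
    using separating_hom_exists by metis
  then show ?thesis
    unfolding markov_algebra_def cluster_variables_def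
    by (intro hull_minimal is_subring_markov_ring) auto
qed

lemma exchange_relation:
  fixes p :: "ratfun3 \<Rightarrow> 'k::field"
  assumes "p \<in> points" "v \<in> markov_algebra" "v' \<in> markov_algebra"
      "u \<in> markov_algebra" "w \<in> markov_algebra"
    and "v \<noteq> 0" "v' = (u\<^sup>2 + w\<^sup>2) / v"
  shows "p v * p v' = (p u)\<^sup>2 + (p w)\<^sup>2"
proof -
  have "v * v' = u * u + w * w" using assms by (simp add: power2_eq_square)
  then have "p (v * v') = p (u * u + w * w)" by simp
  moreover have "u * u \<in> markov_algebra" "w * w \<in> markov_algebra"
    using assms subring_mult[OF is_subring_markov_algebra] by blast+
  ultimately show ?thesis
    using assms(1-5) by (simp add: points_iff ring_hom_on_def power2_eq_square)
qed

lemma cluster_exchange: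
  fixes p :: "ratfun3 \<Rightarrow> 'k::field"
  assumes "p \<in> points" "(a, b, c) \<in> clusters"
  shows "p a * p ((b\<^sup>2 + c\<^sup>2) / a) = (p b)\<^sup>2 + (p c)\<^sup>2"
    and "p b * p ((a\<^sup>2 + c\<^sup>2) / b) = (p a)\<^sup>2 + (p c)\<^sup>2"
    and "p c * p ((a\<^sup>2 + b\<^sup>2) / c) = (p a)\<^sup>2 + (p b)\<^sup>2"
  using assms cluster_nonzero[OF assms(2)] cluster_in_markov_algebra[OF assms(2)]
    cluster_in_markov_algebra(1)[OF clusters.mutate_x] cluster_in_markov_algebra(2)[OF clusters.mutate_y]
    cluster_in_markov_algebra(3)[OF clusters.mutate_z]
  by (auto intro!: exchange_relation)

text \<open>
  If \<open>p\<close> kills \<open>a\<close>, the exchange relation \<open>a a' = b\<^sup>2 + c\<^sup>2\<close> gives \<open>p(b)\<^sup>2 + p(c)\<^sup>2 = 0\<close>, to which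
  \<open>p(a)\<^sup>2 = 0\<close> may be added. The result is symmetric, so it does not depend on which variable of the
  cluster is killed.
\<close>

lemma deep_sum_of_squares:
  fixes p :: "ratfun3 \<Rightarrow> 'k::field"
  assumes "p \<in> deep_points" "(a, b, c) \<in> clusters"
  shows "(p a)\<^sup>2 + (p b)\<^sup>2 + (p c)\<^sup>2 = 0"
proof -
  have "p \<in> points" "p a = 0 \<or> p b = 0 \<or> p c = 0" using assms by (auto simp: deep_points_def)
  with cluster_exchange[OF this(1) assms(2)] show ?thesis by auto
qed

text \<open>
  Both \<open>s\<^sup>2\<close> and \<open>t\<^sup>2\<close> equal \<open>- s t\<close>, so \<open>(s + t)\<^sup>2 = 0\<close>. Since this does not divide by \<open>s\<close>, it covers
  killed variables too, and it works in characteristic two.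
\<close>

lemma mutation_negates:
  fixes s t u w :: "'k::field"
  assumes "s * t = u\<^sup>2 + w\<^sup>2" "s\<^sup>2 + u\<^sup>2 + w\<^sup>2 = 0" "t\<^sup>2 + u\<^sup>2 + w\<^sup>2 = 0"
  shows "t = - s"
proof -
  have "(s + t)\<^sup>2 = (s\<^sup>2 + u\<^sup>2 + w\<^sup>2) + (t\<^sup>2 + u\<^sup>2 + w\<^sup>2) + 2 * (s * t - (u\<^sup>2 + w\<^sup>2))"
    by (simp add: power2_eq_square algebra_simps)
  also have "\<dots> = 0" using assms by simp
  finally show ?thesis by (simp add: eq_neg_iff_add_eq_0 add.commute)
qed

lemma deep_mutation:
  fixes p :: "ratfun3 \<Rightarrow> 'k::field"
  assumes p: "p \<in> deep_points" and cl: "(a, b, c) \<in> clusters"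
  shows "p ((b\<^sup>2 + c\<^sup>2) / a) = - p a" "p ((a\<^sup>2 + c\<^sup>2) / b) = - p b" "p ((a\<^sup>2 + b\<^sup>2) / c) = - p c"
proof -
  have pt: "p \<in> points" using p by (simp add: deep_points_def)
  note ex = cluster_exchange[OF pt cl]
  note sq = deep_sum_of_squares[OF p cl] deep_sum_of_squares[OF p clusters.mutate_x[OF cl]]
    deep_sum_of_squares[OF p clusters.mutate_y[OF cl]] deep_sum_of_squares[OF p clusters.mutate_z[OF cl]]
  show "p ((b\<^sup>2 + c\<^sup>2) / a) = - p a"
    by (rule mutation_negates[OF ex(1)]) (use sq in \<open>simp_all add: ac_simps\<close>)
  show "p ((a\<^sup>2 + c\<^sup>2) / b) = - p b"
    by (rule mutation_negates[OF ex(2)]) (use sq in \<open>simp_all add: ac_simps\<close>)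
  show "p ((a\<^sup>2 + b\<^sup>2) / c) = - p c"
    by (rule mutation_negates[OF ex(3)]) (use sq in \<open>simp_all add: ac_simps\<close>)
qed

lemma deep_cluster_values:
  fixes p :: "ratfun3 \<Rightarrow> 'k::field"
  assumes p: "p \<in> deep_points" and cl: "(a, b, c) \<in> clusters"
  shows "p a \<in> {p var_x, - p var_x} \<and> p b \<in> {p var_y, - p var_y} \<and> p c \<in> {p var_z, - p var_z}"
  using cl
  by (induction a b c rule: clusters.induct[split_format (complete)]) (auto simp: deep_mutation[OF p])

lemma deep_kills_type_iff:
  fixes p :: "ratfun3 \<Rightarrow> 'k::field"
  assumes "p \<in> deep_points"
  shows "(\<forall>a\<in>variables_of_type var_x. p a = 0) \<longleftrightarrow> p var_x = 0"
    and "(\<forall>a\<in>variables_of_type var_y. p a = 0) \<longleftrightarrow> p var_y = 0"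
    and "(\<forall>a\<in>variables_of_type var_z. p a = 0) \<longleftrightarrow> p var_z = 0"
  using deep_cluster_values[OF assms]
  by (fastforce simp: variables_of_type_x_iff variables_of_type_y_iff variables_of_type_z_iff
      intro: clusters.initial)+

lemma deep_point_eqI:
  fixes p q :: "ratfun3 \<Rightarrow> 'k::field"
  assumes p: "p \<in> deep_points" and q: "q \<in> deep_points"
    and eq: "p var_x = q var_x" "p var_y = q var_y" "p var_z = q var_z"
  shows "p = q"
proof -
  have "p a = q a \<and> p b = q b \<and> p c = q c" if "(a, b, c) \<in> clusters" for a b c
    using that by (induction a b c rule: clusters.induct[split_format (complete)])
      (simp_all add: eq deep_mutation[OF p] deep_mutation[OF q])
  then have "p v = q v" if "v \<in> cluster_variables" for v
    using that by (auto simp: cluster_variables_def)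
  moreover have hom: "p \<in> extensional markov_algebra" "q \<in> extensional markov_algebra"
    "ring_hom_on markov_algebra p" "ring_hom_on markov_algebra q"
    using p q by (auto simp: deep_points_def points_iff)
  ultimately have "p v = q v" if "v \<in> markov_algebra" for v
    using that unfolding markov_algebra_def by (blast intro: ring_hom_on_hull_eqI)
  then show ?thesis using hom(1,2) by (blast intro: extensionalityI)
qed

text \<open>
  The point is the restriction of the homomorphism on \<open>markov_ring\<close> with \<open>M\<close> sent to \<open>0\<close>; the
  Markov equation then is the vanishing of the sum of squares.
\<close>

lemma deep_point_exists:
  fixes \<alpha> \<beta> \<gamma> :: "'k::field"
  assumes "\<alpha>\<^sup>2 + \<beta>\<^sup>2 + \<gamma>\<^sup>2 = 0" "\<alpha> = 0 \<or> \<beta> = 0 \<or> \<gamma> = 0"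
  obtains p where "p \<in> deep_points" "p var_x = \<alpha>" "p var_y = \<beta>" "p var_z = \<gamma>"
proof -
  obtain h where h: "ring_hom_on markov_ring h"
    "h var_x = \<alpha>" "h var_y = \<beta>" "h var_z = \<gamma>" "h markov_M = 0"
    using markov_ring_hom_exists[of \<alpha> \<beta> \<gamma> 0] assms(1) by auto
  define p where "p = restrict h markov_algebra"
  have p: "p v = h v" if "v \<in> markov_algebra" for v
    using that by (simp add: p_def)
  have val: "h a \<in> {\<alpha>, - \<alpha>} \<and> h b \<in> {\<beta>, - \<beta>} \<and> h c \<in> {\<gamma>, - \<gamma>}" if "(a, b, c) \<in> clusters" for a b c
    using cluster_values[OF h _ that] cluster_nonzero by blast
  note A = is_subring_markov_algebra
  have "ring_hom_on markov_algebra p"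
    using ring_hom_on_subset[OF h(1) markov_algebra_subset] subring_1[OF A] subring_add[OF A] subring_mult[OF A]
    by (simp add: ring_hom_on_def p)
  then have "p \<in> points" by (simp add: points_iff p_def)
  moreover have "p a = 0 \<or> p b = 0 \<or> p c = 0" if "(a, b, c) \<in> clusters" for a b c
    using val[OF that] assms(2) cluster_in_markov_algebra[OF that] by (auto simp: p)
  ultimately have "p \<in> deep_points" by (auto simp: deep_points_def)
  then show ?thesis
    using that h(2-4) cluster_in_markov_algebra[OF clusters.initial] by (simp add: p)
qed

lemma zero_point_deep:
  "{p \<in> points. \<forall>a\<in>cluster_variables. p a = (0 :: 'k::field)}
    = {p \<in> deep_points. p var_x = 0 \<and> p var_y = 0 \<and> p var_z = 0}"
proof (intro equalityI subsetI)
  fix p :: "ratfun3 \<Rightarrow> 'k"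
  assume "p \<in> {p \<in> points. \<forall>a\<in>cluster_variables. p a = 0}"
  then have p: "p \<in> points" "\<And>a b c. (a, b, c) \<in> clusters \<Longrightarrow> p a = 0 \<and> p b = 0 \<and> p c = 0"
    by (auto simp: cluster_variables_def)
  have "p \<in> deep_points"
    using p by (auto simp: deep_points_def)
  then show "p \<in> {p \<in> deep_points. p var_x = 0 \<and> p var_y = 0 \<and> p var_z = 0}"
    using p(2)[OF clusters.initial] by simp
next
  fix p :: "ratfun3 \<Rightarrow> 'k"
  assume "p \<in> {p \<in> deep_points. p var_x = 0 \<and> p var_y = 0 \<and> p var_z = 0}"
  then have p: "p \<in> deep_points" "p var_x = 0" "p var_y = 0" "p var_z = 0" by auto
  have "p a = 0 \<and> p b = 0 \<and> p c = 0" if "(a, b, c) \<in> clusters" for a b c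
    using deep_cluster_values[OF p(1) that] p(2-4) by simp
  then have "\<forall>a\<in>cluster_variables. p a = 0"
    unfolding cluster_variables_def by blast
  then show "p \<in> {p \<in> points. \<forall>a\<in>cluster_variables. p a = 0}"
    using p(1) by (simp add: deep_points_def)
qed

text \<open>
  In terms of the values at the initial cluster, the three types are the deep points with a zero
  in the respective position. A deep point with two zeros among these values is zero at the third
  initial variable as well, because the sum of squares vanishes, so two types meet only in the
  zero point.
\<close>

theorem proposition5p8:
  defines "DX \<equiv> deep_points_of_type var_x var_y var_z :: (ratfun3 \<Rightarrow> 'k::field) set"
    and "DY \<equiv> deep_points_of_type var_y var_x var_z :: (ratfun3 \<Rightarrow> 'k) set"
    and "DZ \<equiv> deep_points_of_type var_z var_x var_y :: (ratfun3 \<Rightarrow> 'k) set"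
  shows "(\<forall>\<beta> \<gamma> :: 'k. \<beta>\<^sup>2 + \<gamma>\<^sup>2 = 0 \<longrightarrow> (\<exists>!p. p \<in> deep_points_at var_x var_y var_z \<beta> \<gamma>))
    \<and> (\<forall>\<beta> \<gamma> :: 'k. \<beta>\<^sup>2 + \<gamma>\<^sup>2 = 0 \<longrightarrow> (\<exists>!p. p \<in> deep_points_at var_y var_x var_z \<beta> \<gamma>))
    \<and> (\<forall>\<beta> \<gamma> :: 'k. \<beta>\<^sup>2 + \<gamma>\<^sup>2 = 0 \<longrightarrow> (\<exists>!p. p \<in> deep_points_at var_z var_x var_y \<beta> \<gamma>))
    \<and> (deep_points :: (ratfun3 \<Rightarrow> 'k) set) \<subseteq> DX \<union> DY \<union> DZ
    \<and> (\<exists>o\<^sub>0. {p \<in> points. \<forall>a\<in>cluster_variables. p a = 0} = {o\<^sub>0}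
          \<and> DX \<inter> DY = {o\<^sub>0} \<and> DX \<inter> DZ = {o\<^sub>0} \<and> DY \<inter> DZ = {o\<^sub>0})"
proof -
  have at: "deep_points_at var_x var_y var_z \<beta> \<gamma>
      = {p \<in> deep_points. p var_x = 0 \<and> p var_y = \<beta> \<and> p var_z = \<gamma>}"
    "deep_points_at var_y var_x var_z \<beta> \<gamma>
      = {p \<in> deep_points. p var_x = \<beta> \<and> p var_y = 0 \<and> p var_z = \<gamma>}"
    "deep_points_at var_z var_x var_y \<beta> \<gamma>
      = {p \<in> deep_points. p var_x = \<beta> \<and> p var_y = \<gamma> \<and> p var_z = 0}"
    for \<beta> \<gamma> :: 'k
    by (simp_all add: deep_points_at_def deep_kills_type_iff cong: conj_cong) auto
  have ex1: "\<exists>!p. p \<in> deep_points \<and> p var_x = \<alpha> \<and> p var_y = \<beta> \<and> p var_z = \<gamma>"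
    if "\<alpha>\<^sup>2 + \<beta>\<^sup>2 + \<gamma>\<^sup>2 = 0" "\<alpha> = 0 \<or> \<beta> = 0 \<or> \<gamma> = 0" for \<alpha> \<beta> \<gamma> :: 'k
  proof (rule deep_point_exists[OF that])
    fix p :: "ratfun3 \<Rightarrow> 'k"
    assume "p \<in> deep_points" "p var_x = \<alpha>" "p var_y = \<beta>" "p var_z = \<gamma>"
    then show ?thesis by (intro ex1I[of _ p]) (auto intro: deep_point_eqI)
  qed
  have sq: "(p var_x)\<^sup>2 + (p var_y)\<^sup>2 + (p var_z)\<^sup>2 = 0" if "p \<in> deep_points" for p :: "ratfun3 \<Rightarrow> 'k"
    using deep_sum_of_squares[OF that clusters.initial] .
  have "\<exists>\<beta> \<gamma>. \<beta>\<^sup>2 + \<gamma>\<^sup>2 = 0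
      \<and> p \<in> {p \<in> deep_points. p var_x = 0 \<and> p var_y = \<beta> \<and> p var_z = \<gamma>}"
    if "p \<in> deep_points" "p var_x = 0" for p :: "ratfun3 \<Rightarrow> 'k"
    using that sq[OF that(1)] by simp
  moreover have "\<exists>\<beta> \<gamma>. \<beta>\<^sup>2 + \<gamma>\<^sup>2 = 0
      \<and> p \<in> {p \<in> deep_points. p var_x = \<beta> \<and> p var_y = 0 \<and> p var_z = \<gamma>}"
    if "p \<in> deep_points" "p var_y = 0" for p :: "ratfun3 \<Rightarrow> 'k"
    using that sq[OF that(1)] by simp
  moreover have "\<exists>\<beta> \<gamma>. \<beta>\<^sup>2 + \<gamma>\<^sup>2 = 0
      \<and> p \<in> {p \<in> deep_points. p var_x = \<beta> \<and> p var_y = \<gamma> \<and> p var_z = 0}"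
    if "p \<in> deep_points" "p var_z = 0" for p :: "ratfun3 \<Rightarrow> 'k"
    using that sq[OF that(1)] by simp
  ultimately have D: "DX = {p \<in> deep_points. p var_x = 0}" "DY = {p \<in> deep_points. p var_y = 0}"
    "DZ = {p \<in> deep_points. p var_z = 0}"
    unfolding DX_def DY_def DZ_def deep_points_of_type_def at by blast+
  have two: "p var_x = 0 \<and> p var_y = 0 \<and> p var_z = 0"
    if "p \<in> deep_points"
      "p var_x = 0 \<and> p var_y = 0 \<or> p var_x = 0 \<and> p var_z = 0 \<or> p var_y = 0 \<and> p var_z = 0"
    for p :: "ratfun3 \<Rightarrow> 'k"
    using sq[OF that(1)] that(2) by auto
  obtain z :: "ratfun3 \<Rightarrow> 'k" where z: "{p \<in> deep_points. p var_x = 0 \<and> p var_y = 0 \<and> p var_z = 0} = {z}"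
    using ex1[of 0 0 0] by auto
  have "DX \<inter> DY = {z}" "DX \<inter> DZ = {z}" "DY \<inter> DZ = {z}"
    unfolding D z[symmetric] using two by auto
  moreover have "p var_x = 0 \<or> p var_y = 0 \<or> p var_z = 0" if "p \<in> deep_points" for p :: "ratfun3 \<Rightarrow> 'k"
    using that clusters.initial by (auto simp: deep_points_def)
  then have "deep_points \<subseteq> DX \<union> DY \<union> DZ" unfolding D by blast
  moreover have "\<exists>!p. p \<in> deep_points_at var_x var_y var_z \<beta> \<gamma>"
    "\<exists>!p. p \<in> deep_points_at var_y var_x var_z \<beta> \<gamma>"
    "\<exists>!p. p \<in> deep_points_at var_z var_x var_y \<beta> \<gamma>" if "\<beta>\<^sup>2 + \<gamma>\<^sup>2 = 0" for \<beta> \<gamma> :: 'k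
    unfolding at using ex1[of 0 \<beta> \<gamma>] ex1[of \<beta> 0 \<gamma>] ex1[of \<beta> \<gamma> 0] that by simp_all
  ultimately show ?thesis
    unfolding zero_point_deep z by simp
qed

end
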